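(* Let $a,b,c,d\in\mathbf{R}$ with $ad-bc=1$ and $b>0$. Let $f\in L^2(\mathbf{R})$ be such that its linear canonical transform $F^{(a,b,c,d)}$ belongs to $L^1(\mathbf{R})$, and let $g(t)=e^{\mathbf{i}\frac{a}{2b}t^2}f(t)$ for $t\in\mathbf{R}$. For $z\in\mathbf{C}^+$ define $$f_{\mathscr{A}}^{(a,b)}(z):=2\int_0^\infty \mathcal{K}^{(d,-b,-c,a)}(z,\omega)\,F^{(a,b,c,d)}(\omega)\,d\omega .$$ Then $f_{\mathscr{A}}^{(a,b)}$ is holomorphic on the upper half plane $\mathbf{C}^+$. Moreover, for all $x\in\mathbf{R}$ and $y>0$, $$f_{\mathscr{A}}^{(a,b)}(x+\mathbf{i}y)=e^{-\mathbf{i}\frac{a}{2b}(x+\mathbf{i}y)^2}\left[g(x+\mathbf{i}y)+\mathbf{i}\,h(x+\mathbf{i}y)\right],$$ where $$g(x+\mathbf{i}y)=\int_{\mathbf{R}}P_y(x-t)g(t)\,dt,\qquad h(x+\mathbf{i}y)=\int_{\mathbf{R}}Q_y(x-t)g(t)\,dt,$$ and $P_y(x)=\frac{1}{\pi}\frac{y}{x^2+y^2}$, $Q_y(x)=\frac{1}{\pi}\frac{x}{x^2+y^2}$ are the Poisson and conjugate Poisson kernels, respectively.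
   Context: Here $\mathbf{i}$ is the imaginary unit, functions are complex-valued, and $\mathbf{C}^+=\{x+\mathbf{i}y: x\in\mathbf{R},\ y>0\}$. For nonzero complex $z$, $\sqrt z=|z|^{1/2}e^{\mathbf{i}\arg z/2}$ with $\arg z\in(-\pi,\pi]$. For real parameters $(a,b,c,d)$ with $ad-bc=1$ and $b\neq0$, the kernel is $$\mathcal{K}^{(a,b,c,d)}(\omega,x):=\frac{1}{\sqrt{\mathbf{i}2\pi b}}\,e^{\mathbf{i}\left(\frac{d}{2b}\omega^2-\frac1b\omega x+\frac{a}{2b}x^2\right)},$$ and the linear canonical transform (LCT) of $f\in L^1(\mathbf{R})$ is $F^{(a,b,c,d)}(\omega)=\int_{\mathbf{R}}\mathcal{K}^{(a,b,c,d)}(\omega,x)f(x)\,dx$. By Plancherel's theorem the LCT extends from $L^1(\mathbf{R})\cap L^2(\mathbf{R})$ to an isometry of $L^2(\mathbf{R})$; for $f\in L^2(\mathbf{R})$, $F^{(a,b,c,d)}$ denotes this extension. The same formula for the kernel is used with a complex first argument, so that explicitly, for $z\in\mathbf{C}$, $$\mathcal{K}^{(d,-b,-c,a)}(z,\omega)=\frac{1}{\sqrt{-\mathbf{i}2\pi b}}\,e^{\mathbf{i}\left(-\frac{a}{2b}z^2+\frac1b z\omega-\frac{d}{2b}\omega^2\right)}.$$ The symbol $g$ is used both for the function on $\mathbf{R}$ and for its Poisson extension $g(x+\mathbf{i}y)$ to $\mathbf{C}^+$. *)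

theory Defs
  imports "HOL-Analysis.Analysis"
begin

text \<open>Functions on the real line are represented by Lebesgue measurable functions, not by
  classes modulo null sets.\<close>

definition square_integrable :: "(real \<Rightarrow> complex) \<Rightarrow> bool" where
  "square_integrable f \<longleftrightarrow>
     f \<in> borel_measurable lebesgue \<and> integrable lebesgue (\<lambda>x. (cmod (f x))\<^sup>2)"

definition norm_L2 :: "(real \<Rightarrow> complex) \<Rightarrow> real" where
  "norm_L2 f = sqrt (LINT x|lebesgue. (cmod (f x))\<^sup>2)"

text \<open>Membership in \<open>L\<^sup>2\<close> is part of the definition, because the Bochner integral in
  \<^const>\<open>norm_L2\<close> is \<open>0\<close> on functions that are not square integrable.\<close>

definition converges_L2 :: "(nat \<Rightarrow> real \<Rightarrow> complex) \<Rightarrow> (real \<Rightarrow> complex) \<Rightarrow> bool" where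
  "converges_L2 u v \<longleftrightarrow>
     (\<forall>n. square_integrable (u n)) \<and> square_integrable v \<and>
     (\<lambda>n. norm_L2 (\<lambda>x. u n x - v x)) \<longlonglongrightarrow> 0"

text \<open>\<^const>\<open>csqrt\<close> is the branch of the square root whose argument is half of
  \<open>arg z \<in> (-\<pi>, \<pi>]\<close>. The first argument of the kernel is complex, since it is also used
  at points of the upper half plane; the parameter \<open>c\<close> enters only through the constraint
  \<open>a * d - b * c = 1\<close>.\<close>

definition lct_kernel :: "real \<Rightarrow> real \<Rightarrow> real \<Rightarrow> real \<Rightarrow> complex \<Rightarrow> real \<Rightarrow> complex" where
  "lct_kernel a b c d z x =
     1 / csqrt (\<i> * 2 * of_real pi * of_real b) *
     exp (\<i> * (of_real (d / (2 * b)) * z\<^sup>2 - of_real (1 / b) * z * of_real x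
                + of_real (a / (2 * b)) * (of_real x)\<^sup>2))"

definition lct_L1 :: "real \<Rightarrow> real \<Rightarrow> real \<Rightarrow> real \<Rightarrow> (real \<Rightarrow> complex) \<Rightarrow> real \<Rightarrow> complex" where
  "lct_L1 a b c d f \<omega> = (LINT x|lebesgue. lct_kernel a b c d (of_real \<omega>) x * f x)"

text \<open>\<open>is_lct_L2 a b c d f F\<close>: the function \<open>F\<close> represents the image of \<open>f\<close> under the continuous
  extension to \<open>L\<^sup>2\<close> of the transform on \<open>L\<^sup>1 \<inter> L\<^sup>2\<close>. It is a relation because the
  image is determined only almost everywhere.\<close>

definition is_lct_L2 ::
  "real \<Rightarrow> real \<Rightarrow> real \<Rightarrow> real \<Rightarrow> (real \<Rightarrow> complex) \<Rightarrow> (real \<Rightarrow> complex) \<Rightarrow> bool" where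
  "is_lct_L2 a b c d f F \<longleftrightarrow>
     (\<exists>u. (\<forall>n. integrable lebesgue (u n)) \<and> converges_L2 u f \<and>
          converges_L2 (\<lambda>n. lct_L1 a b c d (u n)) F)"

definition upper_half_plane :: "complex set" where
  "upper_half_plane = {z. Im z > 0}"

text \<open>The function \<open>F\<close> stands for the transform of \<open>f\<close> with parameters \<open>a b c d\<close>.\<close>

definition lct_analytic ::
  "real \<Rightarrow> real \<Rightarrow> real \<Rightarrow> real \<Rightarrow> (real \<Rightarrow> complex) \<Rightarrow> complex \<Rightarrow> complex" where
  "lct_analytic a b c d F z =
     2 * (LINT \<omega>:{0..}|lebesgue. lct_kernel d (-b) (-c) a z \<omega> * F \<omega>)"

definition poisson_kernel :: "real \<Rightarrow> real \<Rightarrow> real" where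
  "poisson_kernel y x = 1 / pi * (y / (x\<^sup>2 + y\<^sup>2))"

definition conj_poisson_kernel :: "real \<Rightarrow> real \<Rightarrow> real" where
  "conj_poisson_kernel y x = 1 / pi * (x / (x\<^sup>2 + y\<^sup>2))"

definition poisson_ext :: "(real \<Rightarrow> complex) \<Rightarrow> complex \<Rightarrow> complex" where
  "poisson_ext g z = (LINT t|lebesgue. of_real (poisson_kernel (Im z) (Re z - t)) * g t)"

definition conj_poisson_ext :: "(real \<Rightarrow> complex) \<Rightarrow> complex \<Rightarrow> complex" where
  "conj_poisson_ext g z = (LINT t|lebesgue. of_real (conj_poisson_kernel (Im z) (Re z - t)) * g t)"

end

theory Submission
  imports Defs "HOL-Probability.Sinc_Integral"
begin

text \<open>
  The idea is that both sides are, up to the chirp \<open>exp (- \<i> a z\<^sup>2 / (2 b))\<close>, the Cauchy transform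
  \<open>(\<i> / \<pi>) \<integral> g t / (z - t) dt\<close> of the chirped function \<open>g\<close>.

  For the Poisson side this is pure algebra: \<open>P\<^sub>y(x) + \<i> Q\<^sub>y(x) = (\<i> / \<pi>) / (x + \<i> y)\<close>
  (\<open>poisson_ext_add_conj_poisson_ext\<close>).

  For the transform side, insert the definition of the transform of an integrable function \<open>u\<close> into
  the integral over \<open>\<omega> \<ge> 0\<close>. In the product of the two kernels the chirps in \<open>\<omega>\<close> cancel
  (\<open>lct_kernel_product\<close>), and what remains is \<open>exp (\<i> \<omega> (z - t) / b)\<close>. Since \<open>Im z > 0\<close> and
  \<open>b > 0\<close>, this decays exponentially, Fubini applies, and the integral over \<open>\<omega>\<close> is
  \<open>\<i> b / (z - t)\<close> (\<open>lct_analytic_lct_L1\<close>).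

  The transform of a general square integrable \<open>f\<close> is an \<open>L\<^sup>2\<close> limit of transforms of integrable
  functions \<open>u n\<close> that tend to \<open>f\<close> in \<open>L\<^sup>2\<close>. At a fixed \<open>z\<close> in the upper half plane both sides of
  the identity are pairings with a square integrable kernel: the transform kernel cut off to
  \<open>\<omega> \<ge> 0\<close> on one side, the chirped Cauchy kernel on the other. Pairings are continuous by
  Cauchy--Schwarz, so the identity passes to the limit (\<open>lct_analytic_eq_cauchy_transform\<close>).

  Holomorphy is then read off from the Cauchy transform, whose difference quotients are controlled
  explicitly by the resolvent identity (\<open>cauchy_transform_holomorphic\<close>).
\<close>


section \<open>Integral pairings in \<open>L\<^sup>2\<close>\<close>

lemma square_integrable_mult_integrable:
  assumes "square_integrable u" "square_integrable v"
  shows "integrable lebesgue (\<lambda>x. u x * v x)"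
proof (rule Bochner_Integration.integrable_bound)
  show "integrable lebesgue (\<lambda>x. (cmod (u x))\<^sup>2 + (cmod (v x))\<^sup>2)"
    using assms by (auto simp: square_integrable_def)
  show "(\<lambda>x. u x * v x) \<in> borel_measurable lebesgue"
    using assms by (auto simp: square_integrable_def)
  show "AE x in lebesgue. norm (u x * v x) \<le> norm ((cmod (u x))\<^sup>2 + (cmod (v x))\<^sup>2)"
  proof (rule AE_I2)
    fix x
    have "0 \<le> (cmod (u x) - cmod (v x))\<^sup>2" "0 \<le> cmod (u x) * cmod (v x)" by auto
    then have "cmod (u x) * cmod (v x) \<le> (cmod (u x))\<^sup>2 + (cmod (v x))\<^sup>2"
      unfolding power2_diff by linarith
    then show "norm (u x * v x) \<le> norm ((cmod (u x))\<^sup>2 + (cmod (v x))\<^sup>2)"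
      by (simp add: norm_mult)
  qed
qed

lemma square_integrable_diff:
  assumes "square_integrable u" "square_integrable v"
  shows "square_integrable (\<lambda>x. u x - v x)"
  unfolding square_integrable_def
proof
  show m: "(\<lambda>x. u x - v x) \<in> borel_measurable lebesgue"
    using assms by (auto simp: square_integrable_def)
  show "integrable lebesgue (\<lambda>x. (cmod (u x - v x))\<^sup>2)"
  proof (rule Bochner_Integration.integrable_bound)
    show "integrable lebesgue (\<lambda>x. 2 * (cmod (u x))\<^sup>2 + 2 * (cmod (v x))\<^sup>2)"
      using assms by (auto simp: square_integrable_def)
    show "(\<lambda>x. (cmod (u x - v x))\<^sup>2) \<in> borel_measurable lebesgue"
      using m by measurable
    show "AE x in lebesgue. norm ((cmod (u x - v x))\<^sup>2)
        \<le> norm (2 * (cmod (u x))\<^sup>2 + 2 * (cmod (v x))\<^sup>2)"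
    proof (rule AE_I2)
      fix x
      have "(cmod (u x - v x))\<^sup>2 \<le> (cmod (u x) + cmod (v x))\<^sup>2"
        by (intro power_mono norm_triangle_ineq4) auto
      moreover have "0 \<le> (cmod (u x) - cmod (v x))\<^sup>2" by simp
      ultimately show "norm ((cmod (u x - v x))\<^sup>2) \<le> norm (2 * (cmod (u x))\<^sup>2 + 2 * (cmod (v x))\<^sup>2)"
        by (simp add: power2_sum power2_diff)
    qed
  qed
qed

text \<open>The pairing here is bilinear, without conjugation, as it occurs in the integrals below. The
  bound comes from the quadratic polynomial \<open>s \<mapsto> \<integral> (s\<bar>u\<bar> - \<bar>v\<bar>)\<^sup>2\<close> being nonnegative on the real line.\<close>

lemma cauchy_schwarz_L2:
  assumes u: "square_integrable u" and v: "square_integrable v"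
  shows "cmod (LINT x|lebesgue. u x * v x) \<le> norm_L2 u * norm_L2 v"
proof -
  define A where "A = (LINT x|lebesgue. (cmod (u x))\<^sup>2)"
  define B where "B = (LINT x|lebesgue. (cmod (v x))\<^sup>2)"
  define P where "P = (LINT x|lebesgue. cmod (u x * v x))"
  have iu: "integrable lebesgue (\<lambda>x. (cmod (u x))\<^sup>2)"
    and iv: "integrable lebesgue (\<lambda>x. (cmod (v x))\<^sup>2)"
    and iuv: "integrable lebesgue (\<lambda>x. cmod (u x * v x))"
    using u v square_integrable_mult_integrable[OF u v] by (auto simp: square_integrable_def)
  have nonneg: "0 \<le> A" "0 \<le> B" "0 \<le> P" by (auto simp: A_def B_def P_def)
  have quadratic: "0 \<le> s\<^sup>2 * A - 2 * s * P + B" for s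
  proof -
    have "0 \<le> (LINT x|lebesgue. (s * cmod (u x) - cmod (v x))\<^sup>2)" by simp
    also have "\<dots> = (LINT x|lebesgue. s\<^sup>2 * (cmod (u x))\<^sup>2 - 2 * s * cmod (u x * v x) + (cmod (v x))\<^sup>2)"
      by (simp add: power2_diff power_mult_distrib norm_mult algebra_simps)
    also have "\<dots> = s\<^sup>2 * A - 2 * s * P + B"
      using iu iv iuv by (simp add: A_def B_def P_def)
    finally show ?thesis .
  qed
  have "P\<^sup>2 \<le> A * B"
  proof (cases "A = 0")
    case True
    have "P = 0"
    proof (rule ccontr)
      assume "P \<noteq> 0"
      \<comment> \<open>The polynomial is linear now; at this point its value is \<open>-1\<close>.\<close>
      then show False using quadratic[of "(B + 1) / (2 * P)"] True by simp
    qed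
    then show ?thesis using nonneg by simp
  next
    case False
    then have "0 < A" using nonneg by simp
    \<comment> \<open>\<open>P / A\<close> is the minimum point of the polynomial.\<close>
    then show ?thesis using quadratic[of "P / A"]
      by (simp add: power_divide field_simps power2_eq_square)
  qed
  then have "P \<le> sqrt A * sqrt B"
    by (simp add: real_le_rsqrt flip: real_sqrt_mult)
  moreover have "cmod (LINT x|lebesgue. u x * v x) \<le> P"
    unfolding P_def by (rule integral_norm_bound)
  ultimately show ?thesis by (simp add: norm_L2_def A_def B_def)
qed

text \<open>At a fixed point of the half plane, \<open>lct_analytic\<close> and the Cauchy transform are pairings of this
  kind. By Cauchy--Schwarz they are continuous, which carries an identity between them from \<open>L\<^sup>1 \<inter> L\<^sup>2\<close> to \<open>L\<^sup>2\<close>.\<close>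

lemma converges_L2_integral_mult:
  assumes conv: "converges_L2 u v" and k: "square_integrable k"
  shows "(\<lambda>n. LINT x|lebesgue. k x * u n x) \<longlonglongrightarrow> (LINT x|lebesgue. k x * v x)"
proof -
  have sq: "square_integrable (u n)" "square_integrable v" for n
    using conv by (auto simp: converges_L2_def)
  have lim: "(\<lambda>n. norm_L2 (\<lambda>x. u n x - v x)) \<longlonglongrightarrow> 0"
    using conv by (auto simp: converges_L2_def)
  have "(\<lambda>n. (LINT x|lebesgue. k x * u n x) - (LINT x|lebesgue. k x * v x)) \<longlonglongrightarrow> 0"
  proof (rule Lim_null_comparison)
    show "(\<lambda>n. norm_L2 k * norm_L2 (\<lambda>x. u n x - v x)) \<longlonglongrightarrow> 0"
      using tendsto_mult_left[OF lim, of "norm_L2 k"] by simp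
    have "(LINT x|lebesgue. k x * u n x) - (LINT x|lebesgue. k x * v x)
        = (LINT x|lebesgue. k x * (u n x - v x))" for n
      using square_integrable_mult_integrable[OF k] sq by (simp add: right_diff_distrib)
    then show "\<forall>\<^sub>F n in sequentially. norm ((LINT x|lebesgue. k x * u n x) - (LINT x|lebesgue. k x * v x))
        \<le> norm_L2 k * norm_L2 (\<lambda>x. u n x - v x)"
      using cauchy_schwarz_L2[OF k square_integrable_diff[OF sq]] by simp
  qed
  then show ?thesis by (simp add: LIM_zero_iff)
qed

section \<open>Bounded multipliers\<close>

lemma square_integrable_bounded_mult:
  assumes v: "square_integrable v" and m: "m \<in> borel_measurable lebesgue"
    and bound: "\<And>x. cmod (m x) \<le> C"
  shows "square_integrable (\<lambda>x. m x * v x)"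
  unfolding square_integrable_def
proof
  have [measurable]: "v \<in> borel_measurable lebesgue" "m \<in> borel_measurable lebesgue"
    using v m by (auto simp: square_integrable_def)
  show "(\<lambda>x. m x * v x) \<in> borel_measurable lebesgue" by measurable
  show "integrable lebesgue (\<lambda>x. (cmod (m x * v x))\<^sup>2)"
  proof (rule Bochner_Integration.integrable_bound)
    show "integrable lebesgue (\<lambda>x. C\<^sup>2 * (cmod (v x))\<^sup>2)"
      using v by (auto simp: square_integrable_def)
    show "AE x in lebesgue. norm ((cmod (m x * v x))\<^sup>2) \<le> norm (C\<^sup>2 * (cmod (v x))\<^sup>2)"
      using bound by (auto simp: norm_mult power_mult_distrib intro!: AE_I2 mult_right_mono power_mono)
  qed measurable
qed

lemma norm_L2_bounded_mult:
  assumes v: "square_integrable v" and m: "m \<in> borel_measurable lebesgue"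
    and bound: "\<And>x. cmod (m x) \<le> C"
  shows "norm_L2 (\<lambda>x. m x * v x) \<le> C * norm_L2 v"
proof -
  have C: "0 \<le> C" using bound[of 0] norm_ge_zero order_trans by blast
  have "(LINT x|lebesgue. (cmod (m x * v x))\<^sup>2) \<le> (LINT x|lebesgue. C\<^sup>2 * (cmod (v x))\<^sup>2)"
  proof (rule integral_mono)
    show "integrable lebesgue (\<lambda>x. (cmod (m x * v x))\<^sup>2)"
      using square_integrable_bounded_mult[OF assms] by (simp add: square_integrable_def)
    show "integrable lebesgue (\<lambda>x. C\<^sup>2 * (cmod (v x))\<^sup>2)"
      using v by (simp add: square_integrable_def)
    show "(cmod (m x * v x))\<^sup>2 \<le> C\<^sup>2 * (cmod (v x))\<^sup>2" for x
      using bound by (auto simp: norm_mult power_mult_distrib intro!: mult_right_mono power_mono)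
  qed
  also have "\<dots> = C\<^sup>2 * (LINT x|lebesgue. (cmod (v x))\<^sup>2)"
    by (rule integral_mult_right_zero)
  finally have "norm_L2 (\<lambda>x. m x * v x) \<le> sqrt (C\<^sup>2 * (LINT x|lebesgue. (cmod (v x))\<^sup>2))"
    unfolding norm_L2_def by (rule real_sqrt_le_mono)
  then show ?thesis using C by (simp add: real_sqrt_mult norm_L2_def)
qed

lemma continuous_measurable_lebesgue:
  fixes h :: "real \<Rightarrow> complex"
  assumes "continuous_on UNIV h"
  shows "h \<in> borel_measurable lebesgue"
  using borel_measurable_continuous_onI[OF assms] by (simp add: measurable_completion)

text \<open>The factor is unimodular. With \<open>\<alpha> = a / (2 * b)\<close> it turns \<open>f\<close> into \<open>g\<close>.\<close>

lemma square_integrable_chirp_mult: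
  assumes "square_integrable v"
  shows "square_integrable (\<lambda>t. exp (\<i> * of_real \<alpha> * (of_real t)\<^sup>2) * v t)"
proof (rule square_integrable_bounded_mult[OF assms])
  show "(\<lambda>t. exp (\<i> * of_real \<alpha> * (of_real t)\<^sup>2)) \<in> borel_measurable lebesgue"
    by (rule continuous_measurable_lebesgue) (intro continuous_intros)
  show "cmod (exp (\<i> * of_real \<alpha> * (of_real t)\<^sup>2)) \<le> 1" for t :: real
    by simp
qed

section \<open>Cauchy and exponential kernels\<close>

text \<open>Writing \<open>y = Im z\<close>, the squared modulus is \<open>1 / ((Re z - t)\<^sup>2 + y\<^sup>2)\<close>, an affine image of
  \<open>1 / (1 + s\<^sup>2)\<close>.\<close>

lemma square_integrable_resolvent:
  assumes "Im z \<noteq> 0"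
  shows "square_integrable (\<lambda>t. 1 / (z - of_real t))"
  unfolding square_integrable_def
proof
  have nz: "z - of_real t \<noteq> 0" for t using assms by (auto simp: complex_eq_iff)
  show "(\<lambda>t. 1 / (z - of_real t)) \<in> borel_measurable lebesgue"
    using nz by (intro continuous_measurable_lebesgue continuous_intros) auto
  define y where "y = Im z"
  have y: "y \<noteq> 0" using assms by (simp add: y_def)
  have "integrable lborel (\<lambda>x::real. inverse (1 + x\<^sup>2))"
    using integrable_inverse_1_plus_square by (simp add: set_integrable_def einterval_def)
  then have "integrable lborel (\<lambda>t. 1 / y\<^sup>2 * inverse (1 + (- Re z / y + 1 / y * t)\<^sup>2))"
    using y by (intro integrable_mult_right lborel_integrable_real_affine) auto
  also have "(\<lambda>t. 1 / y\<^sup>2 * inverse (1 + (- Re z / y + 1 / y * t)\<^sup>2))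
      = (\<lambda>t. (cmod (1 / (z - of_real t)))\<^sup>2)"
  proof
    fix t
    have "1 + (- Re z / y + 1 / y * t)\<^sup>2 = (y\<^sup>2 + (Re z - t)\<^sup>2) / y\<^sup>2"
      using y by (simp add: field_simps power2_eq_square)
    moreover have "(cmod (z - of_real t))\<^sup>2 = y\<^sup>2 + (Re z - t)\<^sup>2"
      by (simp add: cmod_power2 y_def)
    ultimately show "1 / y\<^sup>2 * inverse (1 + (- Re z / y + 1 / y * t)\<^sup>2) = (cmod (1 / (z - of_real t)))\<^sup>2"
      using y by (simp add: norm_divide power_divide)
  qed
  finally show "integrable lebesgue (\<lambda>t. (cmod (1 / (z - of_real t)))\<^sup>2)"
    by (simp add: integrable_completion)
qed

lemma set_integrable_exp_halfline:
  assumes "Im w > 0"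
  shows "set_integrable lebesgue {0..} (\<lambda>\<omega>. exp (\<i> * w * of_real \<omega>))"
proof -
  have "set_integrable lebesgue {0..} (\<lambda>\<omega>. exp (- Im w * \<omega>))"
    using assms
    by (intro nonnegative_absolutely_integrable_1 integrable_on_exp_minus_to_infinity) auto
  then show ?thesis
    unfolding set_integrable_def
  proof (rule Bochner_Integration.integrable_bound)
    show "(\<lambda>\<omega>. indicat_real {0..} \<omega> *\<^sub>R exp (\<i> * w * of_real \<omega>)) \<in> borel_measurable lebesgue"
      by (intro borel_measurable_scaleR borel_measurable_indicator continuous_measurable_lebesgue
          continuous_intros) auto
  qed auto
qed

text \<open>This is where the restriction to \<open>\<omega> \<ge> 0\<close> and the half plane meet: the primitive
  \<open>exp (\<i> w \<omega>) / (\<i> w)\<close> vanishes at infinity because \<open>Im w > 0\<close>. The outcome, with \<open>w\<close> a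
  multiple of \<open>z - t\<close>, is the Cauchy kernel.\<close>

lemma integral_exp_halfline:
  assumes w: "Im w > 0"
  shows "(LINT \<omega>:{0..}|lebesgue. exp (\<i> * w * of_real \<omega>)) = \<i> / w"
proof -
  let ?e = "\<lambda>\<omega>. exp (\<i> * w * of_real \<omega>)"
  have w0: "w \<noteq> 0" using w by auto
  have int: "set_integrable lborel {0..} ?e"
    using set_integrable_exp_halfline[OF w] unfolding set_integrable_def
    by (simp add: integrable_completion)
  have "(LBINT \<omega>=0..\<infinity>. ?e \<omega>) = 0 - 1 / (\<i> * w)"
  proof (rule interval_integral_FTC_integrable)
    show "((\<lambda>\<omega>. ?e \<omega> / (\<i> * w)) has_vector_derivative ?e x) (at x)" for x
    proof -
      have "((\<lambda>\<omega>. exp (\<i> * w * \<omega>) / (\<i> * w)) has_field_derivative ?e x) (at (of_real x))"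
        using w0 by (auto intro!: derivative_eq_intros)
      then show ?thesis by (rule has_vector_derivative_real_field)
    qed
    show "set_integrable lborel (einterval 0 \<infinity>) ?e"
      by (rule set_integrable_subset[OF int]) (auto simp: einterval_def)
    show "(((\<lambda>\<omega>. ?e \<omega> / (\<i> * w)) \<circ> real_of_ereal) \<longlongrightarrow> 1 / (\<i> * w)) (at_right 0)"
      unfolding zero_ereal_def ereal_tendsto_simps using w0
      by (auto intro!: tendsto_eq_intros)
    show "(((\<lambda>\<omega>. ?e \<omega> / (\<i> * w)) \<circ> real_of_ereal) \<longlongrightarrow> 0) (at_left \<infinity>)"
      unfolding ereal_tendsto_simps
    proof (rule tendsto_norm_zero_cancel)
      have "((\<lambda>\<omega>. exp (- (Im w * \<omega>)) / cmod w) \<longlongrightarrow> 0) at_top"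
        using w
        by (intro tendsto_divide_zero filterlim_compose[OF exp_at_bot])
          (auto simp: filterlim_uminus_at_bot intro!: filterlim_tendsto_pos_mult_at_top[OF tendsto_const _ filterlim_ident])
      then show "((\<lambda>\<omega>. norm (?e \<omega> / (\<i> * w))) \<longlongrightarrow> 0) at_top"
        by (simp add: norm_divide norm_mult)
    qed
  qed (auto intro!: continuous_intros)
  moreover have "(LBINT \<omega>=0..\<infinity>. ?e \<omega>) = (LINT \<omega>:{0..}|lborel. ?e \<omega>)"
    unfolding zero_ereal_def interval_integral_to_infinity_eq set_lebesgue_integral_def
    by (intro integral_cong_AE) (auto intro!: AE_I[where N = "{0}"] simp: indicator_def)
  moreover have "(LINT \<omega>:{0..}|lebesgue. ?e \<omega>) = (LINT \<omega>:{0..}|lborel. ?e \<omega>)"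
    unfolding set_lebesgue_integral_def by (intro integral_completion) auto
  ultimately have "(LINT \<omega>:{0..}|lebesgue. ?e \<omega>) = 0 - 1 / (\<i> * w)" by simp
  also have "\<dots> = \<i> / w" by (simp add: divide_simps)
  finally show ?thesis .
qed

text \<open>The numbers \<open>\<plusminus>2\<pi>\<i>b\<close> are complex conjugates off the branch cut, so their square roots are
  conjugate too, and the product is the modulus.\<close>

lemma csqrt_product:
  assumes "b > 0"
  shows "csqrt (\<i> * 2 * of_real pi * of_real b) * csqrt (\<i> * 2 * of_real pi * of_real (- b))
    = of_real (2 * pi * b)"
proof -
  let ?s = "\<i> * 2 * of_real pi * of_real b"
  have "?s \<notin> \<real>\<^sub>\<le>\<^sub>0" using assms by (auto simp: complex_nonpos_Reals_iff)
  then have "csqrt (\<i> * 2 * of_real pi * of_real (- b)) = cnj (csqrt ?s)"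
    by (simp add: cnj_csqrt)
  then have "csqrt ?s * csqrt (\<i> * 2 * of_real pi * of_real (- b)) = of_real ((cmod (csqrt ?s))\<^sup>2)"
    by (simp only: complex_norm_square)
  also have "(cmod (csqrt ?s))\<^sup>2 = cmod ((csqrt ?s)\<^sup>2)" by (simp only: norm_power)
  finally show ?thesis using assms by (simp add: norm_mult)
qed

section \<open>The formula for integrable functions\<close>

text \<open>The functions are measurable only with respect to the completed measure, so Fubini is applied
  to the product of two copies of it; for this the completion has to be sigma-finite.\<close>

lemma sigma_finite_lebesgue:
  "sigma_finite_measure (lebesgue :: real measure)"
proof
  obtain A :: "real set set" where "countable A" "A \<subseteq> sets lborel" "\<Union>A = space lborel"
    "\<forall>a\<in>A. emeasure lborel a \<noteq> \<infinity>"
    using lborel.sigma_finite_countable by blast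
  then show "\<exists>A::real set set. countable A \<and> A \<subseteq> sets lebesgue \<and> \<Union> A = space lebesgue
      \<and> (\<forall>a\<in>A. emeasure lebesgue a \<noteq> \<infinity>)"
    by (intro exI[of _ A]) auto
qed

text \<open>The two chirps in \<open>\<omega>\<close>, of opposite rates \<open>\<plusminus>d / (2 * b)\<close>, cancel, so \<open>\<omega>\<close> survives only in a pure
  exponential of frequency \<open>(z - t) / b\<close>.\<close>

lemma lct_kernel_product:
  assumes "b > 0"
  shows "lct_kernel d (- b) (- c) a z \<omega> * lct_kernel a b c d (of_real \<omega>) t =
    exp (- \<i> * of_real (a / (2 * b)) * z\<^sup>2) / of_real (2 * pi * b) *
    (exp (\<i> * of_real (a / (2 * b)) * (of_real t)\<^sup>2) *
     exp (\<i> * ((z - of_real t) / of_real b) * of_real \<omega>))"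
proof -
  have "lct_kernel d (- b) (- c) a z \<omega> * lct_kernel a b c d (of_real \<omega>) t =
    1 / of_real (2 * pi * b) *
    exp (\<i> * (of_real (a / (2 * (- b))) * z\<^sup>2 - of_real (1 / (- b)) * z * of_real \<omega>
                + of_real (d / (2 * (- b))) * (of_real \<omega>)\<^sup>2)
       + \<i> * (of_real (d / (2 * b)) * (of_real \<omega>)\<^sup>2 - of_real (1 / b) * of_real \<omega> * of_real t
                + of_real (a / (2 * b)) * (of_real t)\<^sup>2))"
    unfolding lct_kernel_def exp_add csqrt_product[OF assms, symmetric] by (simp add: mult_ac)
  also have "\<i> * (of_real (a / (2 * (- b))) * z\<^sup>2 - of_real (1 / (- b)) * z * of_real \<omega>
                + of_real (d / (2 * (- b))) * (of_real \<omega>)\<^sup>2)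
       + \<i> * (of_real (d / (2 * b)) * (of_real \<omega>)\<^sup>2 - of_real (1 / b) * of_real \<omega> * of_real t
                + of_real (a / (2 * b)) * (of_real t)\<^sup>2)
     = - \<i> * of_real (a / (2 * b)) * z\<^sup>2 + (\<i> * of_real (a / (2 * b)) * (of_real t)\<^sup>2
        + \<i> * ((z - of_real t) / of_real b) * of_real \<omega>)"
    using assms by (simp add: field_simps)
  finally show ?thesis unfolding exp_add by simp
qed

text \<open>After the order of integration is exchanged, the inner integral over \<open>\<omega>\<close> is a half line
  exponential, hence a Cauchy kernel. The exchange is legitimate because the integrand has modulus
  a constant times \<open>\<bar>u t\<bar> exp (- (Im z / b) \<omega>)\<close>, a product of two integrable functions.\<close>

lemma lct_analytic_lct_L1:
  assumes b: "b > 0" and z: "Im z > 0" and u: "integrable lebesgue u"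
  shows "lct_analytic a b c d (lct_L1 a b c d u) z =
    exp (- \<i> * of_real (a / (2 * b)) * z\<^sup>2) *
    (\<i> / of_real pi * (LINT t|lebesgue. exp (\<i> * of_real (a / (2 * b)) * (of_real t)\<^sup>2) * u t / (z - of_real t)))"
proof -
  interpret L: sigma_finite_measure "lebesgue :: real measure" by (rule sigma_finite_lebesgue)
  interpret P: pair_sigma_finite "lebesgue :: real measure" "lebesgue :: real measure" ..
  define C where "C = exp (- \<i> * of_real (a / (2 * b)) * z\<^sup>2) / of_real (2 * pi * b)"
  define v where "v t = exp (\<i> * of_real (a / (2 * b)) * (of_real t)\<^sup>2) * u t" for t
  define e where "e t \<omega> = exp (\<i> * ((z - of_real t) / of_real b) * of_real \<omega>)" for t \<omega> :: real
  define H where "H t \<omega> = C * (v t * (indicat_real {0..} \<omega> *\<^sub>R e t \<omega>))" for t \<omega>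
  have Im: "Im ((z - of_real t) / of_real b) = Im z / b" for t
    by (simp add: Im_divide_of_real)
  then have pos: "Im ((z - of_real t) / of_real b) > 0" for t using b z by simp
  have norm_e: "cmod (e t \<omega>) = exp (- (Im z / b) * \<omega>)" for t \<omega>
    using Im[of t] by (simp add: e_def)
  have [measurable]: "u \<in> borel_measurable lebesgue" using u by simp
  have chirp [measurable]: "(\<lambda>t. exp (\<i> * of_real (a / (2 * b)) * (of_real t)\<^sup>2)) \<in> borel_measurable lebesgue"
    by (rule continuous_measurable_lebesgue) (intro continuous_intros)
  have v_meas [measurable]: "v \<in> borel_measurable lebesgue" unfolding v_def by measurable
  have v: "integrable lebesgue v"
    by (rule Bochner_Integration.integrable_bound[OF u]) (auto simp: v_def norm_mult)
  have e_int: "integrable lebesgue (\<lambda>\<omega>. indicat_real {0..} \<omega> *\<^sub>R e t \<omega>)" for t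
    using set_integrable_exp_halfline[OF pos] unfolding set_integrable_def e_def .
  have H_int: "integrable (lebesgue \<Otimes>\<^sub>M lebesgue) (case_prod H)"
  proof (rule P.Fubini_integrable)
    have id: "(\<lambda>x::real. x) \<in> borel_measurable lebesgue" by (simp add: measurable_completion)
    have [measurable]: "fst \<in> borel_measurable ((lebesgue :: real measure) \<Otimes>\<^sub>M (lebesgue :: real measure))"
      by (rule measurable_compose[OF measurable_fst id])
    have [measurable]: "snd \<in> borel_measurable ((lebesgue :: real measure) \<Otimes>\<^sub>M (lebesgue :: real measure))"
      by (rule measurable_compose[OF measurable_snd id])
    have [measurable]: "(\<lambda>p. v (fst p)) \<in> borel_measurable (lebesgue \<Otimes>\<^sub>M (lebesgue :: real measure))"
      using measurable_compose[OF measurable_fst v_meas] .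
    have "(\<lambda>p. H (fst p) (snd p)) \<in> borel_measurable (lebesgue \<Otimes>\<^sub>M lebesgue)"
      unfolding H_def e_def by measurable
    then show "case_prod H \<in> borel_measurable (lebesgue \<Otimes>\<^sub>M lebesgue)"
      by (simp add: case_prod_unfold)
    have "(LINT \<omega>|lebesgue. norm (case_prod H (t, \<omega>)))
        = cmod C * cmod (v t) * (LINT \<omega>|lebesgue. indicat_real {0..} \<omega> * exp (- (Im z / b) * \<omega>))" for t
    proof -
      have "norm (case_prod H (t, \<omega>))
          = cmod C * cmod (v t) * (indicat_real {0..} \<omega> * exp (- (Im z / b) * \<omega>))" for \<omega>
        by (simp add: H_def norm_mult norm_e)
      then show ?thesis by (simp only: integral_mult_right_zero)
    qed
    then show "integrable lebesgue (\<lambda>t. LINT \<omega>|lebesgue. norm (case_prod H (t, \<omega>)))"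
      using v by simp
    show "AE t in lebesgue. integrable lebesgue (\<lambda>\<omega>. case_prod H (t, \<omega>))"
      unfolding H_def prod.case by (intro AE_I2 integrable_mult_right e_int)
  qed
  have "(LINT \<omega>:{0..}|lebesgue. lct_kernel d (- b) (- c) a z \<omega> * lct_L1 a b c d u \<omega>)
      = (LINT \<omega>|lebesgue. LINT t|lebesgue. H t \<omega>)"
    unfolding set_lebesgue_integral_def
  proof (rule Bochner_Integration.integral_cong[OF refl])
    fix \<omega> :: real
    have "indicat_real {0..} \<omega> *\<^sub>R (lct_kernel d (- b) (- c) a z \<omega> * lct_L1 a b c d u \<omega>)
      = (LINT t|lebesgue. indicat_real {0..} \<omega> *\<^sub>R
          (lct_kernel d (- b) (- c) a z \<omega> * (lct_kernel a b c d (of_real \<omega>) t * u t)))"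
      by (simp add: lct_L1_def)
    also have "\<dots> = (LINT t|lebesgue. H t \<omega>)"
      by (simp only: lct_kernel_product[OF b] flip: mult.assoc)
        (simp add: H_def C_def v_def e_def scaleR_conv_of_real mult_ac)
    finally show "indicat_real {0..} \<omega> *\<^sub>R (lct_kernel d (- b) (- c) a z \<omega> * lct_L1 a b c d u \<omega>)
      = (LINT t|lebesgue. H t \<omega>)" .
  qed
  also have "\<dots> = (LINT t|lebesgue. LINT \<omega>|lebesgue. H t \<omega>)"
    by (rule P.Fubini_integral[OF H_int])
  also have "\<dots> = (LINT t|lebesgue. C * (\<i> * of_real b) * (v t / (z - of_real t)))"
  proof (rule Bochner_Integration.integral_cong[OF refl])
    fix t :: real
    have "(LINT \<omega>|lebesgue. H t \<omega>) = C * (v t * (LINT \<omega>:{0..}|lebesgue. e t \<omega>))"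
      unfolding H_def set_lebesgue_integral_def by (simp only: integral_mult_right_zero)
    also have "(LINT \<omega>:{0..}|lebesgue. e t \<omega>) = \<i> / ((z - of_real t) / of_real b)"
      unfolding e_def by (rule integral_exp_halfline[OF pos])
    finally show "(LINT \<omega>|lebesgue. H t \<omega>) = C * (\<i> * of_real b) * (v t / (z - of_real t))"
      by simp
  qed
  also have "\<dots> = C * (\<i> * of_real b) * (LINT t|lebesgue. v t / (z - of_real t))"
    by (rule integral_mult_right_zero)
  finally show ?thesis
    using b unfolding lct_analytic_def C_def v_def by simp
qed

section \<open>Poisson kernels\<close>

text \<open>The Poisson kernel and its conjugate combine to a Cauchy kernel:
  \<open>P\<^sub>y(x) + \<i> Q\<^sub>y(x) = (\<i> / \<pi>) / (x + \<i> y)\<close>.\<close>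

lemma poisson_ext_add_conj_poisson_ext:
  assumes g: "square_integrable g" and z: "Im z > 0"
  shows "poisson_ext g z + \<i> * conj_poisson_ext g z
    = \<i> / of_real pi * (LINT t|lebesgue. g t / (z - of_real t))"
proof -
  define r where "r t = 1 / (z - of_real t)" for t :: real
  have r: "square_integrable r"
    unfolding r_def using z by (intro square_integrable_resolvent) auto
  have [measurable]: "r \<in> borel_measurable lebesgue" "g \<in> borel_measurable lebesgue"
    using r g by (auto simp: square_integrable_def)
  have "integrable lebesgue (\<lambda>t. r t * g t)"
    by (rule square_integrable_mult_integrable[OF r g])
  then have int: "integrable lebesgue (\<lambda>t. of_real (Re (r t)) * g t)"
    "integrable lebesgue (\<lambda>t. of_real (Im (r t)) * g t)"
    by (rule Bochner_Integration.integrable_bound;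
        auto simp: norm_mult intro!: mult_right_mono abs_Re_le_cmod abs_Im_le_cmod)+
  have "poisson_kernel (Im z) (Re z - t) = - (1 / pi) * Im (r t)"
    "conj_poisson_kernel (Im z) (Re z - t) = 1 / pi * Re (r t)" for t
    by (simp_all add: r_def poisson_kernel_def conj_poisson_kernel_def Re_divide Im_divide)
  then have "poisson_ext g z + \<i> * conj_poisson_ext g z
    = - (1 / of_real pi) * (LINT t|lebesgue. of_real (Im (r t)) * g t)
      + \<i> * (1 / of_real pi * (LINT t|lebesgue. of_real (Re (r t)) * g t))"
    unfolding poisson_ext_def conj_poisson_ext_def by (simp add: mult.assoc)
  also have "\<dots> = \<i> / of_real pi * ((LINT t|lebesgue. of_real (Re (r t)) * g t)
      + \<i> * (LINT t|lebesgue. of_real (Im (r t)) * g t))"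
    by (simp add: field_simps)
  also have "(LINT t|lebesgue. of_real (Re (r t)) * g t) + \<i> * (LINT t|lebesgue. of_real (Im (r t)) * g t)
    = (LINT t|lebesgue. of_real (Re (r t)) * g t + \<i> * (of_real (Im (r t)) * g t))"
    using int by simp
  also have "\<dots> = (LINT t|lebesgue. (of_real (Re (r t)) + \<i> * of_real (Im (r t))) * g t)"
    by (simp add: algebra_simps)
  finally show ?thesis by (simp add: r_def flip: complex_eq)
qed

section \<open>Holomorphy of Cauchy transforms\<close>

text \<open>The resolvent identity \<open>1/(w-t) - 1/(z-t) = -(w-z) / ((w-t)(z-t))\<close> exhibits the difference
  quotient as an integral. Applied once more, it bounds the distance of this quotient from the
  expected derivative by a multiple of \<open>\<bar>w - z\<bar>\<close>, with Cauchy--Schwarz controlling the integral.\<close>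

lemma cauchy_transform_holomorphic:
  assumes g: "square_integrable g"
  shows "(\<lambda>z. LINT t|lebesgue. g t / (z - of_real t)) holomorphic_on upper_half_plane"
proof -
  define r where "r z t = 1 / (z - of_real t)" for z :: complex and t :: real
  have r: "square_integrable (r z)" if "Im z > 0" for z
    unfolding r_def using that by (intro square_integrable_resolvent) auto
  have r_bound: "cmod (r z t) \<le> 1 / Im z" if "Im z > 0" for z t
  proof -
    have "Im z \<le> cmod (z - of_real t)" using abs_Im_le_cmod[of "z - of_real t"] by simp
    then show ?thesis using that by (simp add: r_def norm_divide frac_le)
  qed
  have r_meas: "r z \<in> borel_measurable lebesgue" if "Im z > 0" for z
    using r[OF that] by (simp add: square_integrable_def)
  have rr: "square_integrable (\<lambda>t. r w t * r z t)" if "Im w > 0" "Im z > 0" for w z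
    by (rule square_integrable_bounded_mult[OF r r_meas r_bound]) (use that in auto)
  have resolvent: "r w t - r z t = - (w - z) * (r w t * r z t)" if "Im w > 0" "Im z > 0" for w z t
  proof -
    have "w \<noteq> of_real t" "z \<noteq> of_real t" using that by auto
    then show ?thesis by (simp add: r_def divide_simps)
  qed
  define I where "I z = (LINT t|lebesgue. r z t * g t)" for z
  define D where "D w z = - (LINT t|lebesgue. r w t * r z t * g t)" for w z
  have quotient: "I w - I z = (w - z) * D w z" if "Im w > 0" "Im z > 0" for w z
  proof -
    have "I w - I z = (LINT t|lebesgue. r w t * g t - r z t * g t)"
      unfolding I_def using that r g by (simp add: square_integrable_mult_integrable)
    also have "\<dots> = (LINT t|lebesgue. - (w - z) * (r w t * r z t * g t))"
      using resolvent[OF that] by (simp add: mult.assoc flip: left_diff_distrib)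
    also have "\<dots> = - (w - z) * (LINT t|lebesgue. r w t * r z t * g t)"
      by (rule integral_mult_right_zero)
    finally show ?thesis by (simp add: D_def algebra_simps)
  qed
  have "(I has_field_derivative D z z) (at z)" if z: "Im z > 0" for z
  proof -
    \<comment> \<open>Staying above height \<open>Im z / 2\<close> bounds \<open>1 / (w - t)\<close> by \<open>2 / Im z\<close>, uniformly in \<open>w\<close>.\<close>
    have near: "\<forall>\<^sub>F w in at z. Im w > Im z / 2 \<and> w \<noteq> z"
    proof -
      have "open {w. Im w > Im z / 2}" by (rule open_halfspace_Im_gt)
      then show ?thesis using z unfolding eventually_at_topological
        by (intro exI[of _ "{w. Im w > Im z / 2}"]) auto
    qed
    define K where "K = 2 / Im z * (norm_L2 (\<lambda>t. r z t * r z t) * norm_L2 g)"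
    have "((\<lambda>w. D w z - D z z) \<longlongrightarrow> 0) (at z)"
    proof (rule Lim_null_comparison)
      show "((\<lambda>w. norm (w - z) * K) \<longlongrightarrow> 0) (at z)"
        by (auto intro!: tendsto_eq_intros)
      show "\<forall>\<^sub>F w in at z. norm (D w z - D z z) \<le> norm (w - z) * K"
        using near
      proof eventually_elim
        case (elim w)
        then have w: "Im w > 0" using z by linarith
        define m where "m t = r w t * g t" for t
        have m: "square_integrable m"
          unfolding m_def by (rule square_integrable_bounded_mult[OF g r_meas r_bound]) (use w in auto)
        have "D w z - D z z = - (LINT t|lebesgue. r w t * r z t * g t - r z t * r z t * g t)"
          unfolding D_def using square_integrable_mult_integrable[OF rr g] w z by simp
        also have "\<dots> = - (LINT t|lebesgue. - (w - z) * (r z t * r z t * m t))"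
        proof -
          have "r w t * r z t * g t - r z t * r z t * g t = - (w - z) * (r z t * r z t * m t)" for t
          proof -
            have "r w t * r z t * g t - r z t * r z t * g t = (r w t - r z t) * (r z t * g t)"
              by (simp add: algebra_simps)
            then show ?thesis unfolding resolvent[OF w z] by (simp add: m_def mult_ac)
          qed
          then show ?thesis by simp
        qed
        also have "\<dots> = (w - z) * (LINT t|lebesgue. r z t * r z t * m t)"
          unfolding integral_mult_right_zero by (simp only: mult_minus_left minus_minus)
        finally have le: "norm (D w z - D z z) \<le> norm (w - z) * (norm_L2 (\<lambda>t. r z t * r z t) * norm_L2 m)"
          using cauchy_schwarz_L2[OF rr[OF z z] m] by (simp add: norm_mult mult_left_mono)
        have "norm_L2 m \<le> 2 / Im z * norm_L2 g"
        proof -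
          have "1 / Im w \<le> 2 / Im z" using elim w z by (simp add: field_simps)
          then have "cmod (r w t) \<le> 2 / Im z" for t using r_bound[OF w, of t] by linarith
          then show ?thesis unfolding m_def by (rule norm_L2_bounded_mult[OF g r_meas[OF w]])
        qed
        then have "norm_L2 (\<lambda>t. r z t * r z t) * norm_L2 m \<le> norm_L2 (\<lambda>t. r z t * r z t) * (2 / Im z * norm_L2 g)"
          by (rule mult_left_mono) (simp add: norm_L2_def)
        also have "\<dots> = K" by (simp add: K_def)
        finally show ?case using le mult_left_mono[OF _ norm_ge_zero] order_trans by blast
      qed
    qed
    then have "((\<lambda>w. D w z) \<longlongrightarrow> D z z) (at z)" by (simp add: LIM_zero_iff)
    then have "((\<lambda>w. (I w - I z) / (w - z)) \<longlongrightarrow> D z z) (at z)"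
    proof (rule Lim_transform_eventually)
      show "\<forall>\<^sub>F w in at z. D w z = (I w - I z) / (w - z)"
        using near by eventually_elim (use quotient z in auto)
    qed
    then show ?thesis by (simp add: has_field_derivative_iff)
  qed
  then have "I holomorphic_on upper_half_plane"
    unfolding holomorphic_on_def field_differentiable_def upper_half_plane_def
    by (blast intro: has_field_derivative_at_within)
  then show ?thesis by (simp add: I_def[abs_def] r_def)
qed

section \<open>The formula for square integrable functions\<close>

text \<open>Up to a unimodular chirp and a constant the kernel is \<open>exp (\<i> (z / b) \<omega>)\<close>, which decays
  exponentially on the half line.\<close>

lemma square_integrable_lct_kernel_halfline:
  assumes b: "b > 0" and z: "Im z > 0"
  shows "square_integrable (\<lambda>\<omega>. indicat_real {0..} \<omega> *\<^sub>R lct_kernel d (- b) (- c) a z \<omega>)"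
proof -
  define C where "C = 1 / csqrt (\<i> * 2 * of_real pi * of_real (- b)) * exp (\<i> * (of_real (a / (2 * (- b))) * z\<^sup>2))"
  define m where "m \<omega> = C * exp (\<i> * of_real (d / (2 * (- b)) * \<omega>\<^sup>2))" for \<omega> :: real
  define v where "v \<omega> = indicat_real {0..} \<omega> *\<^sub>R exp (\<i> * (z / of_real b) * of_real \<omega>)" for \<omega>
  have "square_integrable v"
    unfolding square_integrable_def
  proof
    have pos: "Im (2 * z / of_real b) > 0" "Im (z / of_real b) > 0"
      using b z by (simp_all add: Im_divide_of_real)
    show "v \<in> borel_measurable lebesgue"
      using set_integrable_exp_halfline[OF pos(2)]
      unfolding v_def set_integrable_def by simp
    have "(cmod (v \<omega>))\<^sup>2 = norm (indicat_real {0..} \<omega> *\<^sub>R exp (\<i> * (2 * z / of_real b) * of_real \<omega>))" for \<omega>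
      by (simp add: v_def indicator_def Im_divide_of_real flip: exp_double)
    then show "integrable lebesgue (\<lambda>\<omega>. (cmod (v \<omega>))\<^sup>2)"
      using set_integrable_exp_halfline[OF pos(1)] unfolding set_integrable_def
      by (simp only: integrable_norm)
  qed
  moreover have "m \<in> borel_measurable lebesgue"
    unfolding m_def by (rule continuous_measurable_lebesgue) (intro continuous_intros)
  moreover have "cmod (m \<omega>) \<le> cmod C" for \<omega> by (simp add: m_def norm_mult)
  ultimately have "square_integrable (\<lambda>\<omega>. m \<omega> * v \<omega>)" by (rule square_integrable_bounded_mult)
  also have "(\<lambda>\<omega>. m \<omega> * v \<omega>) = (\<lambda>\<omega>. indicat_real {0..} \<omega> *\<^sub>R lct_kernel d (- b) (- c) a z \<omega>)"
  proof
    fix \<omega> :: real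
    have "\<i> * (of_real (a / (2 * (- b))) * z\<^sup>2 - of_real (1 / (- b)) * z * of_real \<omega>
                + of_real (d / (2 * (- b))) * (of_real \<omega>)\<^sup>2)
      = \<i> * (of_real (a / (2 * (- b))) * z\<^sup>2) + \<i> * of_real (d / (2 * (- b)) * \<omega>\<^sup>2)
        + \<i> * (z / of_real b) * of_real \<omega>"
      by (simp add: algebra_simps)
    then show "m \<omega> * v \<omega> = indicat_real {0..} \<omega> *\<^sub>R lct_kernel d (- b) (- c) a z \<omega>"
      unfolding lct_kernel_def m_def v_def C_def by (simp only: exp_add) (simp add: scaleR_conv_of_real mult_ac)
  qed
  finally show ?thesis .
qed

text \<open>Both sides are pairings with square integrable kernels, of \<open>F\<close> on the left and of \<open>f\<close> on the
  right. They agree along the approximating sequence that defines the transform, hence in the limit.\<close>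

lemma lct_analytic_eq_cauchy_transform:
  assumes b: "b > 0" and z: "Im z > 0" and F: "is_lct_L2 a b c d f F"
  shows "lct_analytic a b c d F z =
    exp (- \<i> * of_real (a / (2 * b)) * z\<^sup>2) *
    (\<i> / of_real pi * (LINT t|lebesgue. exp (\<i> * of_real (a / (2 * b)) * (of_real t)\<^sup>2) * f t / (z - of_real t)))"
proof -
  obtain u where u: "\<And>n. integrable lebesgue (u n)" "converges_L2 u f"
    "converges_L2 (\<lambda>n. lct_L1 a b c d (u n)) F"
    using F by (auto simp: is_lct_L2_def)
  define k where "k \<omega> = indicat_real {0..} \<omega> *\<^sub>R lct_kernel d (- b) (- c) a z \<omega>" for \<omega>
  define q where "q t = exp (\<i> * of_real (a / (2 * b)) * (of_real t)\<^sup>2) * (1 / (z - of_real t))" for t :: real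
  define E where "E = exp (- \<i> * of_real (a / (2 * b)) * z\<^sup>2) * (\<i> / of_real pi)"
  have k: "square_integrable k"
    unfolding k_def by (rule square_integrable_lct_kernel_halfline[OF b z])
  have q: "square_integrable q"
    unfolding q_def using z
    by (intro square_integrable_chirp_mult square_integrable_resolvent) auto
  have analytic: "lct_analytic a b c d G z = 2 * (LINT \<omega>|lebesgue. k \<omega> * G \<omega>)" for G
    by (simp add: lct_analytic_def set_lebesgue_integral_def k_def)
  have cauchy: "(LINT t|lebesgue. exp (\<i> * of_real (a / (2 * b)) * (of_real t)\<^sup>2) * v t / (z - of_real t))
      = (LINT t|lebesgue. q t * v t)" for v
    by (simp add: q_def)
  have "(\<lambda>n. 2 * (LINT \<omega>|lebesgue. k \<omega> * lct_L1 a b c d (u n) \<omega>)) \<longlonglongrightarrow> 2 * (LINT \<omega>|lebesgue. k \<omega> * F \<omega>)"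
    by (intro tendsto_mult_left converges_L2_integral_mult u k)
  moreover have "2 * (LINT \<omega>|lebesgue. k \<omega> * lct_L1 a b c d (u n) \<omega>) = E * (LINT t|lebesgue. q t * u n t)" for n
    using lct_analytic_lct_L1[OF b z u(1), of a c d n] unfolding analytic cauchy E_def
    by (simp only: mult.assoc)
  moreover have "(\<lambda>n. E * (LINT t|lebesgue. q t * u n t)) \<longlonglongrightarrow> E * (LINT t|lebesgue. q t * f t)"
    by (intro tendsto_mult_left converges_L2_integral_mult u q)
  ultimately have "2 * (LINT \<omega>|lebesgue. k \<omega> * F \<omega>) = E * (LINT t|lebesgue. q t * f t)"
    by (simp add: LIMSEQ_unique)
  then show ?thesis unfolding analytic cauchy E_def by (simp only: mult.assoc)
qed

theorem theorem1p2:
  fixes a b c d :: real and f F g :: "real \<Rightarrow> complex"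
  assumes "a * d - b * c = 1" and "b > 0"
    and "square_integrable f"
    and "is_lct_L2 a b c d f F"
    and "integrable lebesgue F"
    and "\<And>t. g t = exp (\<i> * of_real (a / (2 * b)) * (of_real t)\<^sup>2) * f t"
  shows "lct_analytic a b c d F holomorphic_on upper_half_plane \<and>
    (\<forall>x y :: real. y > 0 \<longrightarrow>
      lct_analytic a b c d F (Complex x y) =
        exp (- \<i> * of_real (a / (2 * b)) * (Complex x y)\<^sup>2) *
        (poisson_ext g (Complex x y) + \<i> * conj_poisson_ext g (Complex x y)))"
proof -
  have g_eq: "g = (\<lambda>t. exp (\<i> * of_real (a / (2 * b)) * (of_real t)\<^sup>2) * f t)"
    using assms(6) by auto
  have g: "square_integrable g"
    unfolding g_eq by (rule square_integrable_chirp_mult[OF assms(3)])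
  have cauchy: "lct_analytic a b c d F z = exp (- \<i> * of_real (a / (2 * b)) * z\<^sup>2) *
      (\<i> / of_real pi * (LINT t|lebesgue. g t / (z - of_real t)))" if "Im z > 0" for z
    using lct_analytic_eq_cauchy_transform[OF assms(2) that assms(4)] unfolding g_eq .
  have "lct_analytic a b c d F holomorphic_on upper_half_plane"
  proof (rule holomorphic_transform)
    show "(\<lambda>z. exp (- \<i> * of_real (a / (2 * b)) * z\<^sup>2) *
      (\<i> / of_real pi * (LINT t|lebesgue. g t / (z - of_real t)))) holomorphic_on upper_half_plane"
      by (intro holomorphic_intros cauchy_transform_holomorphic g)
  qed (simp add: cauchy upper_half_plane_def)
  moreover have "lct_analytic a b c d F (Complex x y) =
        exp (- \<i> * of_real (a / (2 * b)) * (Complex x y)\<^sup>2) *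
        (poisson_ext g (Complex x y) + \<i> * conj_poisson_ext g (Complex x y))" if "y > 0" for x y
    using that cauchy[of "Complex x y"] poisson_ext_add_conj_poisson_ext[OF g, of "Complex x y"]
    by simp
  ultimately show ?thesis by blast
qed

end
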